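(* For any connected graphs $G$ and $H$, $$\operatorname{th}_{\rm pd}^{\times}(G\Box H)\ge\operatorname{th}_{\rm pd}^{\times}(G)\quad\text{and}\quad\operatorname{th}_{\rm pd}^{\times}(G\Box H)\ge\operatorname{th}_{\rm pd}^{\times}(H).$$
   Context: All graphs are finite, simple and undirected with at least one vertex. The Cartesian product $G\Box H$ has vertex set $V(G)\times V(H)$, with $(x_1,y_1)$ and $(x_2,y_2)$ adjacent if either $x_1=x_2$ and $y_1y_2\in E(H)$, or $y_1=y_2$ and $x_1x_2\in E(G)$. Let $G$ be a graph and let $N[S]$ denote the closed neighborhood of $S\subseteq V(G)$. For nonempty $S\subseteq V(G)$ define $P^{[0]}(S)=S$, $P^{[1]}(S)=N[S]$, and for $i\ge 1$, $P^{[i+1]}(S)=P^{[i]}(S)\cup\{w\in V(G)\setminus P^{[i]}(S): \exists u\in P^{[i]}(S),\ N(u)\setminus P^{[i]}(S)=\{w\}\}$. $S$ is a power dominating set if $P^{[t]}(S)=V(G)$ for some $t$. The power propagation time $\operatorname{pt}_{\rm pd}(G;S)$ is the least positive integer $t$ with $P^{[t]}(S)=V(G)$ (so it is at least $1$, even for $S=V(G)$), and is $\infty$ if $S$ is not a power dominating set. The product power throttling number is $\operatorname{th}_{\rm pd}^{\times}(G)=\min_{\emptyset\ne S\subseteq V(G)}|S|\operatorname{pt}_{\rm pd}(G;S)$. *)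

theory Defs
  imports "Graph_Theory.Digraph_Component" "HOL-Library.Extended_Nat"
begin

text \<open>
  Finite simple undirected graphs are \<^locale>\<open>pair_graph\<close>s: finite symmetric irreflexive arc
  relations on a finite vertex set.  An edge \<open>xy\<close> is the pair of arcs \<open>(x, y)\<close> and \<open>(y, x)\<close>.
  \<^const>\<open>Digraph_Component.connected\<close> includes that there is at least one vertex.
\<close>

definition nbhd :: "'a pair_pre_digraph \<Rightarrow> 'a \<Rightarrow> 'a set" where
  "nbhd G u = {w. (u, w) \<in> parcs G}"

definition closed_nbhd :: "'a pair_pre_digraph \<Rightarrow> 'a set \<Rightarrow> 'a set" where
  "closed_nbhd G S = S \<union> (\<Union>u\<in>S. nbhd G u)"

definition cart_prod :: "'a pair_pre_digraph \<Rightarrow> 'b pair_pre_digraph \<Rightarrow> ('a \<times> 'b) pair_pre_digraph"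
    (infixl \<open>\<box>\<close> 70) where
  "G \<box> H = \<lparr> pverts = pverts G \<times> pverts H,
     parcs = {((x1, y1), (x2, y2)) | x1 y1 x2 y2.
       (x1 = x2 \<and> x1 \<in> pverts G \<and> (y1, y2) \<in> parcs H) \<or>
       (y1 = y2 \<and> y1 \<in> pverts H \<and> (x1, x2) \<in> parcs G)} \<rparr>"

fun pd_set :: "'a pair_pre_digraph \<Rightarrow> 'a set \<Rightarrow> nat \<Rightarrow> 'a set" where
  "pd_set G S 0 = S"
| "pd_set G S (Suc 0) = closed_nbhd G S"
| "pd_set G S (Suc (Suc i)) = pd_set G S (Suc i) \<union>
     {w \<in> pverts G - pd_set G S (Suc i).
        \<exists>u \<in> pd_set G S (Suc i). nbhd G u - pd_set G S (Suc i) = {w}}"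

definition power_dominating :: "'a pair_pre_digraph \<Rightarrow> 'a set \<Rightarrow> bool" where
  "power_dominating G S \<longleftrightarrow>
     S \<noteq> {} \<and> S \<subseteq> pverts G \<and> (\<exists>t. pd_set G S t = pverts G)"

definition pt_pd :: "'a pair_pre_digraph \<Rightarrow> 'a set \<Rightarrow> enat" where
  "pt_pd G S = (if power_dominating G S
     then enat (LEAST t. 0 < t \<and> pd_set G S t = pverts G) else \<infinity>)"

definition th_pd_prod :: "'a pair_pre_digraph \<Rightarrow> enat" where
  "th_pd_prod G = Min {enat (card S) * pt_pd G S | S. S \<noteq> {} \<and> S \<subseteq> pverts G}"

lemma pair_graph_cart_prod:
  assumes "pair_graph G" "pair_graph H"
  shows "pair_graph (G \<box> H)"
proof -
  interpret G: pair_graph G by fact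
  interpret H: pair_graph H by fact
  have sub: "parcs (G \<box> H) \<subseteq> pverts (G \<box> H) \<times> pverts (G \<box> H)"
    by (auto simp: cart_prod_def dest: G.in_arcsD1 G.in_arcsD2 H.in_arcsD1 H.in_arcsD2)
  have fin: "finite (pverts (G \<box> H))"
    by (simp add: cart_prod_def)
  show ?thesis
  proof
    show "finite (pverts (G \<box> H))" by (fact fin)
    show "finite (parcs (G \<box> H))"
      using sub fin by (meson finite_SigmaI finite_subset)
    show "symmetric (with_proj (G \<box> H))"
      using G.sym_arcs H.sym_arcs
      by (auto simp: symmetric_def sym_def cart_prod_def)
  qed (auto simp: cart_prod_def
      dest: G.in_arcsD1 G.in_arcsD2 H.in_arcsD1 H.in_arcsD2 G.pair_no_loops H.pair_no_loops)
qed

text \<open>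
  The least \<open>t\<close> in \<^const>\<open>pt_pd\<close> and the minimum in \<^const>\<open>th_pd_prod\<close> are attained.
\<close>

lemma pd_set_Suc_0_eq:
  assumes "pair_graph G" "pd_set G S 0 = pverts G"
  shows "pd_set G S (Suc 0) = pverts G"
proof -
  interpret pair_graph G by fact
  show ?thesis
    using assms(2) by (auto simp: closed_nbhd_def nbhd_def dest: in_arcsD2)
qed

lemma pt_pd_attained:
  assumes "pair_graph G" "power_dominating G S"
  obtains t where "pt_pd G S = enat t" "0 < t" "pd_set G S t = pverts G"
proof -
  obtain t where t: "pd_set G S t = pverts G"
    using assms(2) by (auto simp: power_dominating_def)
  have "\<exists>t. 0 < t \<and> pd_set G S t = pverts G"
  proof (cases t)
    case 0
    with t pd_set_Suc_0_eq[OF assms(1)] show ?thesis by (intro exI[of _ "Suc 0"]) simp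
  next
    case (Suc n)
    with t show ?thesis by blast
  qed
  from LeastI_ex[OF this] assms(2) that show ?thesis
    by (simp add: pt_pd_def)
qed

lemma th_pd_prod_attained:
  assumes "pair_graph G" "pverts G \<noteq> {}"
  obtains S where "S \<noteq> {}" "S \<subseteq> pverts G" "th_pd_prod G = enat (card S) * pt_pd G S"
proof -
  interpret pair_graph G by fact
  let ?A = "{S. S \<noteq> {} \<and> S \<subseteq> pverts G}"
  have eq: "{enat (card S) * pt_pd G S | S. S \<noteq> {} \<and> S \<subseteq> pverts G} =
      (\<lambda>S. enat (card S) * pt_pd G S) ` ?A"
    by auto
  have "finite (pverts G)"
    by (rule pair_finite_verts)
  then have "finite ?A"
    by (rule_tac finite_subset[of _ "Pow (pverts G)"]) auto
  moreover have "?A \<noteq> {}"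
    using assms(2) by auto
  ultimately have "th_pd_prod G \<in> (\<lambda>S. enat (card S) * pt_pd G S) ` ?A"
    unfolding th_pd_prod_def eq by (intro Min_in) auto
  with that show ?thesis by auto
qed

end

theory Submission
  imports Defs
begin

text \<open>
  Observed vertices project to observed vertices: if \<open>(g, h)\<close> forces \<open>(g', h)\<close> in \<open>G \<box> H\<close>, then
  the other neighbors of \<open>(g, h)\<close> in its copy of \<open>G\<close> are already observed, so \<open>g\<close> forces \<open>g'\<close> in
  \<open>G\<close> unless \<open>g'\<close> is observed already; a force along a copy of \<open>H\<close> projects to nothing.
  Hence the projection of a power dominating set is power dominating, it is no larger, and it
  propagates at least as fast.
\<close>

lemma pd_set_subset:
  assumes "pair_graph G" "S \<subseteq> pverts G"
  shows "pd_set G S t \<subseteq> pverts G"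
proof -
  interpret pair_graph G by fact
  show ?thesis
    using assms(2) in_arcsD2
    by (induction G S t rule: pd_set.induct) (auto simp: closed_nbhd_def nbhd_def)
qed

lemma pt_pd_le:
  assumes "S \<noteq> {}" "S \<subseteq> pverts G" "0 < t" "pd_set G S t = pverts G"
  shows "pt_pd G S \<le> enat t"
  using assms by (auto simp: pt_pd_def power_dominating_def intro: Least_le)

lemma th_pd_prod_le:
  assumes "pair_graph G" "S \<noteq> {}" "S \<subseteq> pverts G"
  shows "th_pd_prod G \<le> enat (card S) * pt_pd G S"
proof -
  interpret pair_graph G by fact
  have "finite ((\<lambda>S. enat (card S) * pt_pd G S) ` Pow (pverts G))"
    by simp
  then have "finite {enat (card S) * pt_pd G S | S. S \<noteq> {} \<and> S \<subseteq> pverts G}"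
    by (rule rev_finite_subset) auto
  then show ?thesis
    unfolding th_pd_prod_def using assms by (intro Min_le) auto
qed

text \<open>
  Common abstraction of the two projections of a Cartesian product: an edge may be collapsed,
  and every edge at an image vertex lifts.
\<close>

definition collapsing_projection ::
    "('a \<Rightarrow> 'b) \<Rightarrow> 'a pair_pre_digraph \<Rightarrow> 'b pair_pre_digraph \<Rightarrow> bool" where
  "collapsing_projection f K G \<longleftrightarrow> f ` pverts K = pverts G \<and>
     (\<forall>u\<in>pverts K. nbhd G (f u) \<subseteq> f ` nbhd K u \<and> f ` nbhd K u \<subseteq> insert (f u) (nbhd G (f u)))"

text \<open>The two inclusions for neighborhoods are used separately. The upper bound sends an edge
  to an edge or a point, so domination and forces stay local in \<open>G\<close>; lifting ensures
  that a forcing vertex has no extra unobserved neighbor after projection.\<close>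

lemma image_pd_set_subset:
  assumes "pair_graph K" and f: "collapsing_projection f K G" and S: "S \<subseteq> pverts K"
  shows "f ` pd_set K S t \<subseteq> pd_set G (f ` S) t"
\<comment> \<open>The first step dominates and all later ones force, so 0, 1 and n + 2 are separate
  cases.\<close>
proof (induction t rule: induct_nat_012)
  case 0
  show ?case by simp
next
  case 1
  show ?case
  proof
    fix y assume "y \<in> f ` pd_set K S (Suc 0)"
    then obtain x where y: "y = f x" and x: "x \<in> closed_nbhd K S"
      by auto
    show "y \<in> pd_set G (f ` S) (Suc 0)"
    proof (cases "x \<in> S")
      case True
      then show ?thesis
        using y by (simp add: closed_nbhd_def)
    next
      case False
      then obtain u where u: "u \<in> S" "x \<in> nbhd K u"
        using x by (auto simp: closed_nbhd_def)
      then have "f x \<in> insert (f u) (nbhd G (f u))"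
        using f S unfolding collapsing_projection_def by blast
      then show ?thesis
        using y u(1) by (auto simp: closed_nbhd_def)
    qed
  qed
next
  case (ge2 n)
  let ?X = "pd_set K S (Suc n)" and ?Y = "pd_set G (f ` S) (Suc n)"
  have X: "f x \<in> ?Y" if "x \<in> ?X" for x
    using ge2.IH(2) that by blast
  have "f w \<in> pd_set G (f ` S) (Suc (Suc n))"
    if w: "w \<in> pverts K" and u: "u \<in> ?X" and force: "nbhd K u - ?X = {w}" for u w
  proof (cases "f w \<in> ?Y")
    case False
    have uK: "u \<in> pverts K"
      using pd_set_subset[OF assms(1) S] u by blast
    \<comment> \<open>A collapsed edge would put \<open>f w\<close> at \<open>f u\<close>, which is
      already observed.\<close>
    have "f w \<noteq> f u"
      using False X[OF u] by metis
    then have "f w \<in> nbhd G (f u)"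
      using f uK force unfolding collapsing_projection_def by blast
    \<comment> \<open>An unobserved neighbor of \<open>f u\<close> lifts to a neighbor
      \<open>v\<close> of \<open>u\<close>. By induction \<open>v\<close> is unobserved too, hence
      \<open>v\<close> is \<open>w\<close>.\<close>
    moreover have "nbhd G (f u) - ?Y \<subseteq> {f w}"
    proof
      fix y assume y: "y \<in> nbhd G (f u) - ?Y"
      then obtain v where v: "v \<in> nbhd K u" "y = f v"
        using f uK unfolding collapsing_projection_def by blast
      then have "v \<in> nbhd K u - ?X"
        using X y by blast
      then show "y \<in> {f w}"
        using v(2) by (simp add: force)
    qed
    ultimately have "nbhd G (f u) - ?Y = {f w}"
      using False by blast
    moreover have "f w \<in> pverts G"
      using f w unfolding collapsing_projection_def by blast
    ultimately show ?thesis
      using X[OF u] False by auto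
  qed simp
  then show ?case
    using X by auto
qed

lemma th_pd_prod_collapsing_projection:
  assumes "pair_graph K" "pair_graph G" and f: "collapsing_projection f K G"
    and "pverts K \<noteq> {}"
  shows "th_pd_prod G \<le> th_pd_prod K"
proof -
  interpret K: pair_graph K by fact
  obtain S where S: "S \<noteq> {}" "S \<subseteq> pverts K" and th: "th_pd_prod K = enat (card S) * pt_pd K S"
    using th_pd_prod_attained assms(1,4) by blast
  have fin: "finite S"
    using S(2) K.pair_finite_verts finite_subset by blast
  have fS: "f ` S \<noteq> {}" "f ` S \<subseteq> pverts G"
    using S f unfolding collapsing_projection_def by blast+
  have "pt_pd G (f ` S) \<le> pt_pd K S"
  \<comment> \<open>Otherwise \<open>pt_pd K S\<close> is infinite and the bound is trivial.\<close>
  proof (cases "power_dominating K S")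
    case True
    then obtain t where t: "pt_pd K S = enat t" "0 < t" "pd_set K S t = pverts K"
      using pt_pd_attained assms(1) by blast
    have "pverts G \<subseteq> pd_set G (f ` S) t"
      using image_pd_set_subset[OF assms(1) f S(2), of t] t(3) f
      by (simp add: collapsing_projection_def)
    then have "pd_set G (f ` S) t = pverts G"
      using pd_set_subset[OF assms(2) fS(2)] by blast
    then show ?thesis
      using pt_pd_le fS t by metis
  qed (simp add: pt_pd_def)
  moreover have "enat (card (f ` S)) \<le> enat (card S)"
    using fin by (simp add: card_image_le)
  ultimately have "enat (card (f ` S)) * pt_pd G (f ` S) \<le> th_pd_prod K"
    unfolding th by (intro mult_mono) auto
  then show ?thesis
    using th_pd_prod_le[OF assms(2) fS] by (rule order_trans[rotated])
qed

lemma pverts_cart_prod: "pverts (G \<box> H) = pverts G \<times> pverts H"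
  by (simp add: cart_prod_def)

lemma nbhd_cart_prod:
  assumes "x \<in> pverts G" "y \<in> pverts H"
  shows "nbhd (G \<box> H) (x, y) = {x} \<times> nbhd H y \<union> nbhd G x \<times> {y}"
  using assms by (auto simp: nbhd_def cart_prod_def)

text \<open>Of the two parts of a product neighborhood, the \<open>H\<close> part collapses to the
  point itself and the \<open>G\<close> part maps bijectively onto the neighborhood in
  \<open>G\<close>. A vertex of \<open>H\<close> makes \<open>fst\<close> surjective.\<close>

lemma collapsing_projection_fst:
  assumes "pverts H \<noteq> {}"
  shows "collapsing_projection fst (G \<box> H) G"
  unfolding collapsing_projection_def
proof (intro conjI ballI)
  show "fst ` pverts (G \<box> H) = pverts G"
    using assms by (simp add: pverts_cart_prod)
qed (auto simp: pverts_cart_prod nbhd_cart_prod image_Un)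

lemma collapsing_projection_snd:
  assumes "pverts G \<noteq> {}"
  shows "collapsing_projection snd (G \<box> H) H"
  unfolding collapsing_projection_def
proof (intro conjI ballI)
  show "snd ` pverts (G \<box> H) = pverts H"
    using assms by (simp add: pverts_cart_prod)
qed (auto simp: pverts_cart_prod nbhd_cart_prod image_Un)

theorem theorem6p6:
  fixes G :: "'a pair_pre_digraph" and H :: "'b pair_pre_digraph"
  assumes "pair_graph G" and "pair_graph H"
    and "Digraph_Component.connected (with_proj G)"
    and "Digraph_Component.connected (with_proj H)"
  shows "th_pd_prod (G \<box> H) \<ge> th_pd_prod G \<and> th_pd_prod (G \<box> H) \<ge> th_pd_prod H"
proof -
  \<comment> \<open>Connectedness includes nonemptiness, which makes both coordinate maps
    surjective.\<close>
  have ne: "pverts G \<noteq> {}" "pverts H \<noteq> {}"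
    using assms(3,4) by (auto simp: connected_def strongly_connected_def)
  then have "pverts (G \<box> H) \<noteq> {}"
    by (simp add: pverts_cart_prod)
  moreover have "pair_graph (G \<box> H)"
    using assms(1,2) by (rule pair_graph_cart_prod)
  ultimately show ?thesis
    using th_pd_prod_collapsing_projection assms(1,2)
      collapsing_projection_fst[OF ne(2)] collapsing_projection_snd[OF ne(1)]
    by metis
qed

end
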